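(* Let $-1\le B<A\le 1$. Let $c,\lambda,b\in\mathbb{C}$ with $c\neq 0$, and let $\kappa=\lambda+\frac{b+1}{2}$ with $\kappa\ne 0,-1,-2,-3,\dots$. Suppose that the one of the following conditions corresponding to the values of $A,B$ holds: (i) if $-1=B<A\le 3-2\sqrt2$: $$\operatorname{Re}\kappa\ge \frac{|c|}{4(1+A)}\left(\sqrt{2(1+A^2)}+(1-A)\right);$$ (ii) if $B=-1$ and $A>3-2\sqrt2$: $$\operatorname{Re}\kappa\ge\frac{|c|(1+A)}{8\sqrt A}\quad\text{and}\quad \operatorname{Re}\kappa\le \frac{|c|(1+A)}{4(1-A)}$$ (when $A=1$ the second inequality is read as no condition); (iii) if $-1<B<0$: $$\operatorname{Re}\kappa\ge\frac{|c|(1+A)(1-B)^2}{4(A-B)(1+B)}-\frac{1+B}{1-B};$$ (iv) if $B\ge 0$: $$\operatorname{Re}\kappa\ge\frac{|c|(1+A)(1+B)}{4(A-B)}-\frac{1-B}{1+B}.$$ If $(1+B)u_{\lambda+1}(z)\ne 1+A$ for all $z\in\mathbb{D}$, then the function $z\mapsto -\frac{4\kappa}{c}u_\lambda'(z)$ belongs to $\mathcal{P}[A,B]$.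
   Context: $\mathbb{D}=\{z\in\mathbb{C}:|z|<1\}$. For $b,\lambda,c\in\mathbb{C}$ with $\kappa=\lambda+\frac{b+1}{2}\ne 0,-1,-2,\dots$, the normalized generalized Bessel function $u_\lambda=u_{\lambda,b,c}$ is the entire function $$u_\lambda(z)=\sum_{k=0}^\infty\frac{(-1)^kc^k}{4^k(\kappa)_k}\frac{z^k}{k!},$$ where $(\kappa)_k=\kappa(\kappa+1)\cdots(\kappa+k-1)$, $(\kappa)_0=1$. The function $u_{\lambda+1}=u_{\lambda+1,b,c}$ is defined by the same series with $\kappa$ replaced by $\kappa+1$. For $f,g$ analytic in $\mathbb{D}$, $f\prec g$ ($f$ is subordinate to $g$) means that there is an analytic $w:\mathbb{D}\to\mathbb{D}$ with $w(0)=0$ and $f=g\circ w$. For $-1\le B<A\le1$, $\mathcal{P}[A,B]$ is the family of functions $p$ analytic in $\mathbb{D}$ with $p(0)=1$ and $p(z)\prec\frac{1+Az}{1+Bz}$. *)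

theory Defs
  imports "HOL-Complex_Analysis.Complex_Analysis"
begin

definition bessel_kappa :: "complex \<Rightarrow> complex \<Rightarrow> complex" where
  "bessel_kappa lam b = lam + (b + 1) / 2"

text \<open>
  The normalized generalized Bessel function. Its defining series is meaningful only when
  \<open>bessel_kappa lam b\<close> is not a non-positive integer; otherwise some denominators vanish and
  the corresponding terms are \<open>0\<close> by the convention \<open>x / 0 = 0\<close>.
\<close>

definition gen_bessel :: "complex \<Rightarrow> complex \<Rightarrow> complex \<Rightarrow> complex \<Rightarrow> complex" where
  "gen_bessel lam b c z =
     (\<Sum>k. (-1) ^ k * c ^ k / (4 ^ k * pochhammer (bessel_kappa lam b) k) * (z ^ k / fact k))"

definition subordinate :: "(complex \<Rightarrow> complex) \<Rightarrow> (complex \<Rightarrow> complex) \<Rightarrow> bool" where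
  "subordinate f g \<longleftrightarrow>
     f holomorphic_on ball 0 1 \<and> g holomorphic_on ball 0 1 \<and>
     (\<exists>w. w holomorphic_on ball 0 1 \<and> w ` ball 0 1 \<subseteq> ball 0 1 \<and> w 0 = 0 \<and>
          (\<forall>z\<in>ball 0 1. f z = g (w z)))"

definition janowski_class :: "real \<Rightarrow> real \<Rightarrow> (complex \<Rightarrow> complex) set" where
  "janowski_class A B =
     {p. p holomorphic_on ball 0 1 \<and> p 0 = 1 \<and>
         subordinate p (\<lambda>z. (1 + of_real A * z) / (1 + of_real B * z))}"

end

theory Submission
  imports Defs
begin

text \<open>
  Differentiating the series term by term shows that \<open>- (4 * \<kappa> / c) * u\<^sub>\<lambda>'\<close> is nothing but
  \<open>u = u\<^sub>\<lambda>\<^sub>+\<^sub>1\<close>, and comparing coefficients shows that \<open>u\<close> solves the second-order equation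
  \<open>z * u'' + (\<kappa> + 1) * u' = q * u\<close> with \<open>q = - c / 4\<close>. So the claim is \<open>u \<in> \<P>[A, B]\<close>.

  The Janowski function \<open>(1 + A w) / (1 + B w)\<close>, precomposed with the Cayley transform
  \<open>w = (p - 1) / (p + 1)\<close>, is \<open>N / D\<close> with \<open>N = (1 - A) + (1 + A) * p\<close> and
  \<open>D = (1 - B) + (1 + B) * p\<close>. Solving \<open>u = N / D\<close> for \<open>p\<close> gives a function that is holomorphic
  because \<open>(1 + B) * u \<noteq> 1 + A\<close>, has \<open>p 0 = 1\<close>, and has positive real part iff \<open>u \<in> \<P>[A, B]\<close>.
  The equation for \<open>u\<close> becomes
  \<open>z\<^sup>2 p'' - 2 (1 + B) (z p')\<^sup>2 / D + (\<kappa> + 1) z p' + c z N D / (8 (A - B)) = 0\<close>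
  (\<open>transformed_ode\<close>).

  If \<open>Re p\<close> were not positive, the second-order lemma of Miller and Mocanu
  (\<open>first_exit_from_right_half_plane\<close>) would give a point of the disc where \<open>p = \<i> \<rho>\<close>,
  \<open>z p' = s\<close> is real with \<open>s \<le> - (1 + \<rho>\<^sup>2) / 2\<close>, and \<open>s + Re (z\<^sup>2 p'') \<le> 0\<close>. At such a point the
  real part of the equation is a negative quantity, of size at least \<open>(1 + \<rho>\<^sup>2) / 2\<close> times a
  coercivity constant, plus a term bounded by \<open>|c z| |N| |D| / (8 (A - B))\<close>. The lower bounds on
  \<open>Re \<kappa>\<close> are what makes the former dominate for every \<open>\<rho>\<close>
  (\<open>janowski_conditions_dominate\<close>), and the strict inequality \<open>|z| < 1\<close> then makes the real part
  negative, a contradiction (\<open>ode_excludes_imaginary_value\<close>).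
\<close>

section \<open>The generalized Bessel series and its differential equation\<close>

text \<open>
  Formal power series make both the derivative formula and the differential equation a comparison
  of coefficients; the parameter \<open>q\<close> stands for \<open>- c / 4\<close>.
\<close>

definition bessel_fps :: "complex \<Rightarrow> complex \<Rightarrow> complex fps" where
  "bessel_fps \<kappa> q = Abs_fps (\<lambda>k. q ^ k / (pochhammer \<kappa> k * fact k))"

lemma gen_bessel_eq_eval_fps:
  "gen_bessel lam b c z = eval_fps (bessel_fps (bessel_kappa lam b) (- c / 4)) z"
  unfolding gen_bessel_def eval_fps_def bessel_fps_def
  by (intro arg_cong[of _ _ suminf] ext)
     (simp add: power_minus[of "c / 4"] power_divide)

lemma pochhammer_nonzero:
  fixes \<kappa> :: complex
  assumes "\<kappa> \<notin> \<int>\<^sub>\<le>\<^sub>0"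
  shows "pochhammer \<kappa> k \<noteq> 0" "\<kappa> + of_nat k \<noteq> 0"
  using assms pochhammer_eq_0_imp_nonpos_Int[of \<kappa> k] 
    pochhammer_eq_0_imp_nonpos_Int[of \<kappa> "Suc k"] by (auto simp: pochhammer_rec')

text \<open>
  Each coefficient is \<open>(\<kappa> + n) * (n + 1) / q\<close> times the next one, a factor that tends to infinity.
\<close>

lemma bessel_fps_conv_radius:
  assumes "\<kappa> \<notin> \<int>\<^sub>\<le>\<^sub>0" "q \<noteq> 0"
  shows "fps_conv_radius (bessel_fps \<kappa> q) = \<infinity>"
  unfolding fps_conv_radius_def
proof (rule conv_radius_ratio_limit_ereal_nonzero)
  let ?a = "fps_nth (bessel_fps \<kappa> q)"
  have ratio: "norm (?a n) / norm (?a (Suc n)) = norm (\<kappa> + of_nat n) * real (Suc n) / norm q" for n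
  proof -
    let ?k = "(\<kappa> + of_nat n) * of_nat (Suc n) / q"
    have "?a n = ?a (Suc n) * ?k"
      using pochhammer_nonzero[OF assms(1), of n] assms(2)
      by (simp add: bessel_fps_def pochhammer_rec' divide_simps of_nat_neq_0 del: of_nat_Suc)
    then have eq: "norm (?a n) = norm (?a (Suc n)) * norm ?k"
      by (metis norm_mult)
    have nz: "norm (?a (Suc n)) \<noteq> 0"
      using pochhammer_nonzero[OF assms(1), of "Suc n"] assms(2)
      by (simp add: bessel_fps_def of_nat_neq_0 del: of_nat_Suc)
    have "norm (?a n) / norm (?a (Suc n)) = norm ?k"
      unfolding eq using nz by (rule nonzero_mult_div_cancel_left)
    then show ?thesis by (simp only: norm_mult norm_divide norm_of_nat)
  qed
  have lim: "filterlim (\<lambda>n. (real n - norm \<kappa>) * 1 / norm q) at_top sequentially"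
    using assms(2) by real_asymp
  have le: "(real n - norm \<kappa>) * 1 / norm q \<le> norm (?a n) / norm (?a (Suc n))" for n
    unfolding ratio
  proof (intro divide_right_mono)
    have "real n - norm \<kappa> \<le> norm (\<kappa> + of_nat n)"
      using norm_triangle_ineq2[of "of_nat n" "-\<kappa>"] by (simp add: add.commute)
    then have "real n - norm \<kappa> \<le> norm (\<kappa> + of_nat n) * 1" by simp
    also have "\<dots> \<le> norm (\<kappa> + of_nat n) * real (Suc n)"
      by (intro mult_left_mono) auto
    finally show "(real n - norm \<kappa>) * 1 \<le> norm (\<kappa> + of_nat n) * real (Suc n)" by simp
  qed auto
  have "filterlim (\<lambda>n. norm (?a n) / norm (?a (Suc n))) at_top sequentially"
    by (intro filterlim_at_top_mono[OF lim] always_eventually allI le)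
  then show "(\<lambda>n. ereal (norm (?a n) / norm (?a (Suc n)))) \<longlonglongrightarrow> \<infinity>"
    by (simp add: tendsto_PInfty_eq_at_top)
qed simp

lemma fps_deriv_bessel_fps:
  "fps_deriv (bessel_fps \<kappa> q) = fps_const (q / \<kappa>) * bessel_fps (\<kappa> + 1) q"
  by (rule fps_ext) (simp add: bessel_fps_def pochhammer_rec field_simps del: of_nat_Suc)

text \<open>
  The coefficient of \<open>z ^ n\<close> on the left is \<open>(n + \<kappa>) * (n + 1) * a (n + 1)\<close>, so the equation is
  the two-term recurrence of the coefficients \<open>a\<close>.
\<close>

lemma bessel_fps_ode:
  assumes "\<kappa> \<notin> \<int>\<^sub>\<le>\<^sub>0"
  shows "fps_X * fps_deriv (fps_deriv (bessel_fps \<kappa> q)) + fps_const \<kappa> * fps_deriv (bessel_fps \<kappa> q)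
           = fps_const q * bessel_fps \<kappa> q" (is "?L = ?R")
proof (rule fps_ext)
  fix n
  have "fps_nth ?L n = (of_nat n + \<kappa>) * (of_nat (Suc n) * fps_nth (bessel_fps \<kappa> q) (Suc n))"
    by (cases n) (simp_all add: algebra_simps)
  also have "\<dots> = fps_nth ?R n"
    using pochhammer_nonzero[OF assms, of n]
    by (simp add: bessel_fps_def pochhammer_rec' divide_simps of_nat_neq_0 add.commute
        del: of_nat_Suc)
  finally show "fps_nth ?L n = fps_nth ?R n" .
qed

section \<open>Leaving the right half-plane\<close>

lemma second_derivative_nonneg_at_min:
  fixes h h' :: "real \<Rightarrow> real"
  assumes h: "\<And>x. (h has_real_derivative h' x) (at x)"
    and h': "(h' has_real_derivative l) (at a)"
    and min: "\<And>x. h a \<le> h x"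
  shows "h' a = 0" "l \<ge> 0"
proof -
  show zero: "h' a = 0"
    using DERIV_local_min[OF h[of a], of 1] min by auto
  show "l \<ge> 0"
  proof (rule ccontr)
    assume "\<not> l \<ge> 0"
    then obtain d where d: "d > 0" "\<And>x. 0 < x \<Longrightarrow> x < d \<Longrightarrow> h' (a + x) < 0"
      using DERIV_neg_dec_right[OF h'] zero by auto
    have "h (a + d / 2) < h a"
    proof (rule DERIV_neg_imp_decreasing_open[of a "a + d/2" h])
      fix x assume "a < x" "x < a + d / 2"
      then show "\<exists>y. (h has_real_derivative y) (at x) \<and> y < 0"
        using d(1) d(2)[of "x - a"] h[of x] by auto
    qed (use d h in \<open>auto intro!: continuous_at_imp_continuous_on DERIV_isCont\<close>)
    with min[of "a + d / 2"] show False by simp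
  qed
qed

lemma has_real_derivative_Re_of_real:
  assumes "(f has_field_derivative f') (at (of_real t))"
  shows "((\<lambda>t. Re (f (of_real t))) has_real_derivative Re f') (at t)"
    and "((\<lambda>t. Im (f (of_real t))) has_real_derivative Im f') (at t)"
  using has_vector_derivative_real_field[OF assms]
  by (auto simp: has_vector_derivative_complex_iff)
 
lemma cayley_norm_less_1:
  fixes q :: complex
  assumes "Re q > 0"
  shows "norm ((q - 1) / (q + 1)) < 1"
proof -
  have "(norm (q - 1))\<^sup>2 < (norm (q + 1))\<^sup>2"
    unfolding cmod_power2 using assms by (simp add: power2_eq_square algebra_simps)
  then have "norm (q - 1) < norm (q + 1)" using power_less_imp_less_base by fastforce
  moreover have "q + 1 \<noteq> 0" using assms by (auto simp: complex_eq_iff)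
  ultimately show ?thesis by (simp add: norm_divide)
qed

text \<open>
  Take \<open>z\<close> of least modulus among the points with \<open>Re (p z) \<le> 0\<close>. On the circle through \<open>z\<close> the
  function \<open>Re p\<close> has its minimum \<open>0\<close> at \<open>z\<close>: the first derivative in the angle vanishes, so
  \<open>z * p1 z\<close> is real, and the second one is nonnegative, which is the last inequality. The bound
  on \<open>s\<close> comes from the radial direction: by the Schwarz lemma the Cayley transform of \<open>p\<close> satisfies
  \<open>|\<phi> t| \<le> t\<close> on the segment from \<open>0\<close> to \<open>z\<close>, with equality at \<open>z\<close>, so \<open>|\<phi> t|\<^sup>2 - t\<^sup>2\<close> cannot
  decrease at \<open>t = 1\<close>.
\<close>

lemma first_exit_from_right_half_plane:
  fixes p p1 p2 :: "complex \<Rightarrow> complex"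
  assumes p1: "\<And>z. z \<in> ball 0 1 \<Longrightarrow> (p has_field_derivative p1 z) (at z)"
    and p2: "\<And>z. z \<in> ball 0 1 \<Longrightarrow> (p1 has_field_derivative p2 z) (at z)"
    and p0: "p 0 = 1"
    and exits: "z1 \<in> ball 0 1" "Re (p z1) \<le> 0"
  obtains z :: complex and \<rho> s :: real
  where "z \<in> ball 0 1" "p z = \<i> * of_real \<rho>" "z * p1 z = of_real s"
    "s \<le> - (1 + \<rho>\<^sup>2) / 2" "s + Re (z\<^sup>2 * p2 z) \<le> 0"
proof -
  define K where "K = {z \<in> cball 0 (norm z1). Re (p z) \<le> 0}"
  have cont: "continuous_on (ball 0 1) p"
    using p1 by (auto intro!: continuous_at_imp_continuous_on DERIV_isCont)
  have "compact K"
  proof -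
    have "continuous_on (cball 0 (norm z1)) (\<lambda>z. Re (p z))"
      using exits(1) by (intro continuous_intros continuous_on_subset[OF cont]) auto
    then have "closed (cball 0 (norm z1) \<inter> (\<lambda>z. Re (p z)) -` {..0})"
      by (intro continuous_closed_preimage) auto
    moreover have "K = cball 0 (norm z1) \<inter> (\<lambda>z. Re (p z)) -` {..0}"
      by (auto simp: K_def)
    ultimately show ?thesis
      by (metis bounded_Int bounded_cball compact_eq_bounded_closed)
  qed
  moreover have "z1 \<in> K" using exits by (simp add: K_def)
  ultimately obtain z where z: "z \<in> K" "\<And>y. y \<in> K \<Longrightarrow> norm z \<le> norm y"
    using continuous_attains_inf[of K norm] by (auto intro: continuous_intros)
  have z_disc: "z \<in> ball 0 1" using z(1) exits(1) by (auto simp: K_def)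
  have inside: "Re (p y) > 0" if "norm y < norm z" for y
  proof (rule ccontr)
    assume "\<not> Re (p y) > 0"
    then have "y \<in> K" using that z(1) by (auto simp: K_def)
    then show False using z(2) that by fastforce
  qed
  have "z \<noteq> 0" using z(1) p0 by (auto simp: K_def)

  \<comment> \<open>Points of the bounding circle are radial limits of points inside.\<close>
  have closed: "Re (p y) \<ge> 0" if "norm y \<le> norm z" for y
  proof (cases "norm y < norm z")
    case False
    with that have ny: "norm y = norm z" by simp
    have in1: "y \<in> ball 0 1" using ny z_disc by simp
    have "(\<lambda>n. of_real (1 - 1 / (real n + 2)) * y) \<longlonglongrightarrow> of_real 1 * y"
      by (intro tendsto_intros) real_asymp
    then have "(\<lambda>n. Re (p (of_real (1 - 1 / (real n + 2)) * y))) \<longlonglongrightarrow> Re (p y)"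
      using p1[OF in1] by (intro tendsto_Re isCont_tendsto_compose[of y p]) (auto intro: DERIV_isCont)
    moreover have "Re (p (of_real (1 - 1 / (real n + 2)) * y)) \<ge> 0" for n
    proof (intro less_imp_le inside)
      have "norm (of_real (1 - 1 / (real n + 2)) * y) = (1 - 1 / (real n + 2)) * norm z"
        unfolding norm_mult norm_of_real ny by simp
      also have "\<dots> < 1 * norm z" using \<open>z \<noteq> 0\<close> by (intro mult_strict_right_mono) auto
      finally show "norm (of_real (1 - 1 / (real n + 2)) * y) < norm z" by simp
    qed
    ultimately show ?thesis by (intro LIMSEQ_le_const) auto
  qed (use inside in \<open>auto intro: less_imp_le\<close>)
  have Re0: "Re (p z) = 0" using z(1) closed[of z] by (auto simp: K_def)

  let ?\<gamma> = "\<lambda>w. z * exp (\<i> * w)"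
  have circ: "?\<gamma> (of_real t) \<in> ball 0 1" "norm (?\<gamma> (of_real t)) = norm z" for t :: real
    using z_disc by (auto simp: norm_mult)
  have d\<gamma>: "(?\<gamma> has_field_derivative \<i> * ?\<gamma> w) (at w)" for w
    by (auto intro!: derivative_eq_intros)
  have d1: "((\<lambda>w. p (?\<gamma> w)) has_field_derivative \<i> * (?\<gamma> w * p1 (?\<gamma> w))) (at w)"
    if "?\<gamma> w \<in> ball 0 1" for w
    using DERIV_chain2[where f = p and g = ?\<gamma>, OF p1[OF that] d\<gamma>] by (simp add: mult_ac)
  have d2: "((\<lambda>w. \<i> * (?\<gamma> w * p1 (?\<gamma> w))) has_field_derivative
              - (?\<gamma> w * p1 (?\<gamma> w) + (?\<gamma> w)\<^sup>2 * p2 (?\<gamma> w))) (at w)"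
    if "?\<gamma> w \<in> ball 0 1" for w
  proof -
    have "((\<lambda>w. p1 (?\<gamma> w)) has_field_derivative p2 (?\<gamma> w) * (\<i> * ?\<gamma> w)) (at w)"
      using DERIV_chain2[where f = p1 and g = ?\<gamma>, OF p2[OF that] d\<gamma>] .
    from DERIV_cmult[OF DERIV_mult[OF d\<gamma> this], of \<i>]
    show ?thesis by (simp add: algebra_simps power2_eq_square)
  qed
  define h where "h = (\<lambda>t::real. Re (p (?\<gamma> (of_real t))))"
  define h' where "h' = (\<lambda>t::real. Re (\<i> * (?\<gamma> (of_real t) * p1 (?\<gamma> (of_real t)))))"
  have "(h has_real_derivative h' t) (at t)" for t
    unfolding h_def h'_def by (rule has_real_derivative_Re_of_real d1 circ)+
  moreover have "(h' has_real_derivative Re (- (z * p1 z + z\<^sup>2 * p2 z))) (at 0)"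
    unfolding h'_def using has_real_derivative_Re_of_real(1)[OF d2, of 0] z_disc by simp
  moreover have "h 0 \<le> h t" for t
    unfolding h_def using closed circ(2)[of t] Re0 by simp
  ultimately have "h' 0 = 0" "Re (- (z * p1 z + z\<^sup>2 * p2 z)) \<ge> 0"
    using second_derivative_nonneg_at_min[of h h' _ 0] by blast+
  then have Im0: "Im (z * p1 z) = 0" and mu: "Re (z * p1 z) + Re (z\<^sup>2 * p2 z) \<le> 0"
    by (auto simp: h'_def)

  \<comment> \<open>Clearing denominators, \<open>g t \<ge> 0\<close> says that \<open>|\<phi> t| \<le> t\<close>; this form makes sense at \<open>t = 1\<close>
    and needs the derivative of \<open>p\<close> alone.\<close>
  define g where "g = (\<lambda>t::real. 4 * Re (p (of_real t * z)) -
    (1 - t\<^sup>2) * ((Re (p (of_real t * z)) + 1)\<^sup>2 + (Im (p (of_real t * z)))\<^sup>2))"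
  define \<phi> where "\<phi> = (\<lambda>y. (p (z * y) - 1) / (p (z * y) + 1))"
  have zy: "z * y \<in> ball 0 1" "norm (z * y) < norm z" if "norm y < 1" for y
  proof -
    have "norm (z * y) < norm z * 1" unfolding norm_mult
      using that \<open>z \<noteq> 0\<close> by (intro mult_strict_left_mono) auto
    then show "norm (z * y) < norm z" "z * y \<in> ball 0 1" using z_disc by auto
  qed
  have ne: "p (z * y) + 1 \<noteq> 0" if "norm y < 1" for y
    using inside[OF zy(2)[OF that]] by (auto simp: complex_eq_iff)
  have p_hol: "p holomorphic_on ball 0 1"
    unfolding holomorphic_on_open[OF open_ball] using p1 by blast
  have "(*) z ` ball 0 1 \<subseteq> ball 0 1"
    by (intro image_subsetI zy(1)) simp
  then have "(\<lambda>y. p (z * y)) holomorphic_on ball 0 1"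
    using holomorphic_on_compose_gen[OF _ p_hol, of "\<lambda>y. z * y" "ball 0 1"]
    by (auto simp: o_def intro!: holomorphic_intros)
  then have \<phi>_hol: "\<phi> holomorphic_on ball 0 1"
    unfolding \<phi>_def using ne by (intro holomorphic_intros) auto
  have schwarz: "norm (\<phi> y) \<le> norm y" if "norm y < 1" for y
    using that
    by (intro Schwarz_Lemma(1)[OF \<phi>_hol])
       (use cayley_norm_less_1 inside zy p0 in \<open>auto simp: \<phi>_def\<close>)
  have g_nonneg: "g t \<ge> 0" if "0 < t" "t < 1" for t
  proof -
    let ?q = "p (of_real t * z)"
    have "norm (?q - 1) \<le> t * norm (?q + 1)"
      using schwarz[of "of_real t"] ne[of "of_real t"] that
      by (simp add: \<phi>_def norm_divide mult.commute divide_le_eq)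
    then have "(norm (?q - 1))\<^sup>2 \<le> t\<^sup>2 * (norm (?q + 1))\<^sup>2"
      by (metis norm_ge_zero power_mono power_mult_distrib)
    then show ?thesis
      by (simp add: g_def cmod_power2) (simp add: power2_eq_square algebra_simps)
  qed
  define \<rho> where "\<rho> = Im (p z)"
  define s where "s = Re (z * p1 z)"
  have dp: "((\<lambda>w. p (w * z)) has_field_derivative z * p1 z) (at (of_real 1))"
  proof -
    have "((\<lambda>w. w * z) has_field_derivative z) (at 1)"
      by (auto intro!: derivative_eq_intros)
    moreover have "(p has_field_derivative p1 z) (at (1 * z))"
      using p1[OF z_disc] by simp
    ultimately have "((\<lambda>w. p (w * z)) has_field_derivative p1 z * z) (at 1)"
      by (rule DERIV_chain2[rotated])
    then show ?thesis by (simp add: mult.commute)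
  qed
  note dR = has_real_derivative_Re_of_real[OF dp]
  have g': "(g has_real_derivative 4 * s + 2 * (1 + \<rho>\<^sup>2)) (at 1)"
    unfolding g_def
    by (rule derivative_eq_intros dR refl)+
       (simp add: Re0 s_def \<rho>_def power2_eq_square algebra_simps)
  have "4 * s + 2 * (1 + \<rho>\<^sup>2) \<le> 0"
  proof (rule ccontr)
    assume "\<not> ?thesis"
    then obtain d where d: "d > 0" "\<And>h. 0 < h \<Longrightarrow> h < d \<Longrightarrow> g (1 - h) < g 1"
      using DERIV_pos_inc_left[OF g'] by auto
    have "g 1 = 0" by (simp add: g_def Re0)
    moreover obtain e where "0 < e" "e < d" "e < 1"
      using d(1) field_lbound_gt_zero[of d 1] by auto
    ultimately show False
      using d(2)[of e] g_nonneg[of "1 - e"] by auto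
  qed
  then have "s \<le> - (1 + \<rho>\<^sup>2) / 2" by simp
  moreover have "p z = \<i> * of_real \<rho>" by (simp add: complex_eq_iff Re0 \<rho>_def)
  moreover have "z * p1 z = of_real s" using Im0 by (simp add: complex_eq_iff s_def)
  moreover have "s + Re (z\<^sup>2 * p2 z) \<le> 0" using mu by (simp add: s_def)
  ultimately show ?thesis using that z_disc by blast
qed

section \<open>From the lower bounds on \<open>Re \<kappa>\<close> to domination\<close>

lemma weighted_sum_le:
  fixes x n t :: real
  assumes "\<bar>1 - x\<bar> \<le> n" "\<bar>1 + x\<bar> \<le> n"
  shows "(1 - x)\<^sup>2 + (1 + x)\<^sup>2 * t\<^sup>2 \<le> n\<^sup>2 * (1 + t\<^sup>2)"
proof -
  have "(1 - x)\<^sup>2 \<le> n\<^sup>2" "(1 + x)\<^sup>2 \<le> n\<^sup>2"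
    using assms by (simp_all add: abs_le_square_iff[symmetric])
  then have "(1 - x)\<^sup>2 + (1 + x)\<^sup>2 * t\<^sup>2 \<le> n\<^sup>2 + n\<^sup>2 * t\<^sup>2"
    by (intro add_mono mult_right_mono) auto
  then show ?thesis by (simp add: algebra_simps)
qed

text \<open>
  Where \<open>p = \<i> * \<rho>\<close>, the terms of the transformed equation other than the one with \<open>c\<close>
  have a sum of real part at most \<open>s * coercivity B (Re \<kappa>) \<rho>\<close>. The fraction is the contribution of
  \<open>- 2 * (1 + B) * s\<^sup>2 / D\<close>, evaluated at the extreme value \<open>s = - (1 + \<rho>\<^sup>2) / 2\<close>.
\<close>

definition coercivity :: "real \<Rightarrow> real \<Rightarrow> real \<Rightarrow> real" where
  "coercivity B r \<rho> = r + (1 - B\<^sup>2) * (1 + \<rho>\<^sup>2) / ((1 - B)\<^sup>2 + (1 + B)\<^sup>2 * \<rho>\<^sup>2)"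

text \<open>
  The two square roots are \<open>|N|\<close> and \<open>|D|\<close> at \<open>p = \<i> * \<rho>\<close>, and \<open>m\<close> stands for \<open>|c|\<close>; the inequality
  says that \<open>m * |N| * |D| / (8 * (A - B))\<close> is at most \<open>(1 + \<rho>\<^sup>2) / 2\<close> times the coercivity.
\<close>

definition dominates :: "real \<Rightarrow> real \<Rightarrow> real \<Rightarrow> real \<Rightarrow> real \<Rightarrow> bool" where
  "dominates A B m r \<rho> \<longleftrightarrow> coercivity B r \<rho> > 0 \<and>
     m * (sqrt ((1 - A)\<^sup>2 + (1 + A)\<^sup>2 * \<rho>\<^sup>2) * sqrt ((1 - B)\<^sup>2 + (1 + B)\<^sup>2 * \<rho>\<^sup>2))
       \<le> 4 * (A - B) * (1 + \<rho>\<^sup>2) * coercivity B r \<rho>"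

text \<open>
  For \<open>B > -1\<close> the bounds \<open>|N| \<le> n * sqrt (1 + \<rho>\<^sup>2)\<close> and \<open>|D| \<le> e * sqrt (1 + \<rho>\<^sup>2)\<close> cancel the
  dependence on \<open>\<rho>\<close>: the second also bounds the coercivity below by \<open>r + (1 - B\<^sup>2) / e\<^sup>2\<close>.
\<close>

lemma dominates_if_uniform_bounds:
  assumes B: "-1 < B" "B < 1" and "B < A" and m: "m > 0"
    and n: "\<bar>1 - A\<bar> \<le> n" "\<bar>1 + A\<bar> \<le> n" and e: "1 - B \<le> e" "1 + B \<le> e"
    and r: "r + (1 - B\<^sup>2) / e\<^sup>2 \<ge> m * n * e / (4 * (A - B))"
  shows "dominates A B m r \<rho>"
proof -
  let ?T = "1 + \<rho>\<^sup>2" and ?E = "(1 - B)\<^sup>2 + (1 + B)\<^sup>2 * \<rho>\<^sup>2" and ?N = "(1 - A)\<^sup>2 + (1 + A)\<^sup>2 * \<rho>\<^sup>2"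
  have T: "?T > 0" by (simp add: add_pos_nonneg)
  have "n > 0" "e > 0" using n e B by auto
  have E: "?E > 0" using B by (simp add: add_pos_nonneg)
  have E_le: "?E \<le> e\<^sup>2 * ?T" using weighted_sum_le[of B e \<rho>] e B by auto
  have N_le: "?N \<le> n\<^sup>2 * ?T" using weighted_sum_le[of A n \<rho>] n by auto
  have B2: "1 - B\<^sup>2 > 0" using B by (simp add: abs_square_less_1)
  have "(1 - B\<^sup>2) / e\<^sup>2 \<le> (1 - B\<^sup>2) * ?T / ?E"
    using mult_left_mono[OF E_le, of "1 - B\<^sup>2"] E \<open>e > 0\<close> B2 by (simp add: divide_simps mult_ac)
  then have coer: "coercivity B r \<rho> \<ge> m * n * e / (4 * (A - B))"
    using r by (simp add: coercivity_def)
  moreover have "m * n * e / (4 * (A - B)) > 0"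
    using m \<open>n > 0\<close> \<open>e > 0\<close> \<open>B < A\<close> by simp
  moreover have "sqrt ?N * sqrt ?E \<le> (n * sqrt ?T) * (e * sqrt ?T)"
  proof (intro mult_mono)
    show "sqrt ?N \<le> n * sqrt ?T"
      using real_sqrt_le_mono[OF N_le] \<open>n > 0\<close> by (simp add: real_sqrt_mult)
    show "sqrt ?E \<le> e * sqrt ?T"
      using real_sqrt_le_mono[OF E_le] \<open>e > 0\<close> by (simp add: real_sqrt_mult)
  qed (use \<open>n > 0\<close> E T in auto)
  then have "m * (sqrt ?N * sqrt ?E) \<le> m * (n * e * ?T)"
    using m T by (intro mult_left_mono) (simp_all add: mult_ac)
  moreover have "m * (n * e * ?T) = 4 * (A - B) * ?T * (m * n * e / (4 * (A - B)))"
    using \<open>B < A\<close> by simp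
  moreover have "\<dots> \<le> 4 * (A - B) * ?T * coercivity B r \<rho>"
    using coer T \<open>B < A\<close> by (intro mult_left_mono) auto
  ultimately show ?thesis by (simp add: dominates_def)
qed

text \<open>
  For \<open>B = -1\<close> the Janowski domain is a half-plane, \<open>D = 2\<close> is constant and the coercivity is just
  \<open>r\<close>. Then \<open>|N|\<close> only has to grow at most like \<open>1 + \<rho>\<^sup>2\<close>, and \<open>k\<close> is a bound for
  \<open>|N| / (1 + \<rho>\<^sup>2)\<close>.
\<close>

lemma dominates_if_half_plane:
  assumes A: "-1 < A" and m: "m > 0" and k: "k > 0"
    and N: "(1 - A)\<^sup>2 + (1 + A)\<^sup>2 * \<rho>\<^sup>2 \<le> (k * (1 + \<rho>\<^sup>2))\<^sup>2"
    and r: "r \<ge> m * k / (2 * (1 + A))"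
  shows "dominates A (-1) m r \<rho>"
proof -
  let ?N = "(1 - A)\<^sup>2 + (1 + A)\<^sup>2 * \<rho>\<^sup>2"
  have T: "1 + \<rho>\<^sup>2 > 0" by (simp add: add_pos_nonneg)
  have "sqrt ?N \<le> k * (1 + \<rho>\<^sup>2)"
    using real_sqrt_le_mono[OF N] k T by simp
  then have "m * sqrt ?N \<le> m * (k * (1 + \<rho>\<^sup>2))" using m by (intro mult_left_mono) auto
  also have "\<dots> = (1 + \<rho>\<^sup>2) * (m * k)" by simp
  also have "\<dots> \<le> (1 + \<rho>\<^sup>2) * (r * (2 * (1 + A)))"
    using r A T by (intro mult_left_mono) (auto simp: field_simps)
  finally have "m * sqrt ?N \<le> (1 + \<rho>\<^sup>2) * (r * (2 * (1 + A)))" .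
  moreover have "r > 0"
  proof -
    have "0 < m * k / (2 * (1 + A))" using m k A by simp
    then show ?thesis using r by linarith
  qed
  ultimately show ?thesis by (simp add: dominates_def coercivity_def algebra_simps)
qed

text \<open>
  For \<open>B = -1\<close>, the maximum over \<open>\<rho>\<close> of \<open>|N| / (1 + \<rho>\<^sup>2)\<close> is attained at
  \<open>\<rho>\<^sup>2 = 1 - 2 * (1 - A)\<^sup>2 / (1 + A)\<^sup>2\<close> if this is nonnegative and at \<open>\<rho> = 0\<close> otherwise. The threshold
  \<open>3 - 2 * sqrt 2\<close> separates the two situations, the maxima being \<open>(1 + A)\<^sup>2 / (4 * sqrt A)\<close> and
  \<open>1 - A\<close>. For \<open>B > -1\<close> the uniform bounds apply with \<open>e = 1 + |B|\<close>.
\<close>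

lemma janowski_conditions_dominate:
  fixes A B m r :: real
  assumes AB: "-1 \<le> B" "B < A" "A \<le> 1" and m: "m > 0"
    and i: "B = -1 \<and> A \<le> 3 - 2 * sqrt 2 \<Longrightarrow>
           r \<ge> m / (4 * (1 + A)) * (sqrt (2 * (1 + A\<^sup>2)) + (1 - A))"
    and ii: "B = -1 \<and> A > 3 - 2 * sqrt 2 \<Longrightarrow> r \<ge> m * (1 + A) / (8 * sqrt A)"
    and iii: "-1 < B \<and> B < 0 \<Longrightarrow>
           r \<ge> m * (1 + A) * (1 - B)\<^sup>2 / (4 * (A - B) * (1 + B)) - (1 + B) / (1 - B)"
    and iv: "B \<ge> 0 \<Longrightarrow>
           r \<ge> m * (1 + A) * (1 + B) / (4 * (A - B)) - (1 - B) / (1 + B)"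
  shows "dominates A B m r \<rho>"
proof -
  have sq: "1 < sqrt (2::real)" "sqrt (2::real) < 3/2" by (simp, rule real_less_lsqrt) (simp_all add: power2_eq_square)
  consider (1) "B = -1" "A \<le> 3 - 2 * sqrt 2" | (2) "B = -1" "A > 3 - 2 * sqrt 2"
    | (3) "-1 < B" "B < 0" | (4) "B \<ge> 0" using AB by linarith
  then show ?thesis
  proof cases
    case 1
    have "A < 1" using 1 sq by linarith
    have "(2 * sqrt 2)\<^sup>2 \<le> (3 - A)\<^sup>2" using 1 by (intro power_mono) auto
    then have crit: "(1 + A)\<^sup>2 \<le> 2 * (1 - A)\<^sup>2"
      by (simp add: power2_eq_square algebra_simps)
    have "dominates A (-1) m r \<rho>"
    proof (rule dominates_if_half_plane)
      \<comment> \<open>Expanding \<open>(1 + \<rho>\<^sup>2)\<^sup>2\<close>, the critical inequality takes care of the term in \<open>\<rho>\<^sup>2\<close>.\<close>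
      have "(1 + A)\<^sup>2 * \<rho>\<^sup>2 \<le> 2 * (1 - A)\<^sup>2 * \<rho>\<^sup>2" by (intro mult_right_mono crit) auto
      then have "(1 - A)\<^sup>2 + (1 + A)\<^sup>2 * \<rho>\<^sup>2 \<le> (1 - A)\<^sup>2 + 2 * (1 - A)\<^sup>2 * \<rho>\<^sup>2 + (1 - A)\<^sup>2 * (\<rho>\<^sup>2)\<^sup>2"
        by (smt (verit) mult_nonneg_nonneg zero_le_power2)
      also have "\<dots> = ((1 - A) * (1 + \<rho>\<^sup>2))\<^sup>2" by algebra
      finally show "(1 - A)\<^sup>2 + (1 + A)\<^sup>2 * \<rho>\<^sup>2 \<le> ((1 - A) * (1 + \<rho>\<^sup>2))\<^sup>2" .
      have "1 - A \<le> sqrt (2 * (1 + A\<^sup>2))"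
      proof (rule real_le_rsqrt)
        have "0 \<le> (1 + A)\<^sup>2" by simp
        then show "(1 - A)\<^sup>2 \<le> 2 * (1 + A\<^sup>2)" by (simp add: power2_eq_square algebra_simps)
      qed
      then have "m / (4 * (1 + A)) * ((1 - A) + (1 - A)) \<le> r"
        using i 1 m AB by (smt (verit) divide_nonneg_pos mult_left_mono)
      moreover have "m / (4 * (1 + A)) * ((1 - A) + (1 - A)) = m * (1 - A) / (2 * (1 + A))"
        using AB by (simp add: divide_simps) (simp add: algebra_simps)
      ultimately show "m * (1 - A) / (2 * (1 + A)) \<le> r" by simp
    qed (use 1 AB m \<open>A < 1\<close> in auto)
    then show ?thesis using 1 by simp
  next
    case 2
    have "A > 0" using 2 sq by linarith
    have "dominates A (-1) m r \<rho>"
    proof (rule dominates_if_half_plane)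
      \<comment> \<open>This square vanishes exactly at the maximum point of \<open>|N| / (1 + \<rho>\<^sup>2)\<close>.\<close>
      have "0 \<le> ((1 + A)\<^sup>2 * (1 + \<rho>\<^sup>2) - 8 * A)\<^sup>2" by simp
      also have "\<dots> = ((1 + A)\<^sup>2 * (1 + \<rho>\<^sup>2))\<^sup>2 - 16 * A * ((1 - A)\<^sup>2 + (1 + A)\<^sup>2 * \<rho>\<^sup>2)"
        by algebra
      finally show "(1 - A)\<^sup>2 + (1 + A)\<^sup>2 * \<rho>\<^sup>2 \<le> ((1 + A)\<^sup>2 / (4 * sqrt A) * (1 + \<rho>\<^sup>2))\<^sup>2"
        using \<open>A > 0\<close> by (simp add: power_mult_distrib power_divide field_simps)
      have "m * ((1 + A)\<^sup>2 / (4 * sqrt A)) / (2 * (1 + A)) = m * (1 + A) / (8 * sqrt A)"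
        using \<open>A > 0\<close> by (simp add: power2_eq_square divide_simps)
      then show "m * ((1 + A)\<^sup>2 / (4 * sqrt A)) / (2 * (1 + A)) \<le> r" using ii 2 by simp
    qed (use AB m \<open>A > 0\<close> in auto)
    then show ?thesis using 2 by simp
  next
    case 3
    show ?thesis
    proof (rule dominates_if_uniform_bounds)
      \<comment> \<open>The bound \<open>n = (1 + A) * (1 - B) / (1 + B)\<close> covers \<open>1 - A\<close> because \<open>A > B\<close>, and
        \<open>1 + A\<close> because \<open>B < 0\<close>.\<close>
      have "(1 - A) * (1 + B) \<le> (1 + A) * (1 - B)" using AB by (simp add: algebra_simps)
      then show "\<bar>1 - A\<bar> \<le> (1 + A) * (1 - B) / (1 + B)" using 3 AB by (simp add: field_simps)
      have "(1 + A) * (1 + B) \<le> (1 + A) * (1 - B)" using 3 AB by (intro mult_left_mono) auto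
      then show "\<bar>1 + A\<bar> \<le> (1 + A) * (1 - B) / (1 + B)" using 3 AB by (simp add: field_simps)
      have "(1 - B\<^sup>2) / (1 - B)\<^sup>2 = (1 + B) / (1 - B)"
        using 3 by (simp add: power2_eq_square divide_simps) (simp add: algebra_simps)
      moreover have "m * ((1 + A) * (1 - B) / (1 + B)) * (1 - B) / (4 * (A - B))
          = m * (1 + A) * (1 - B)\<^sup>2 / (4 * (A - B) * (1 + B))"
        by (simp add: power2_eq_square mult_ac)
      ultimately show "m * ((1 + A) * (1 - B) / (1 + B)) * (1 - B) / (4 * (A - B))
          \<le> r + (1 - B\<^sup>2) / (1 - B)\<^sup>2"
        using iii 3 by linarith
    qed (use 3 AB m in auto)
  next
    case 4
    show ?thesis
    proof (rule dominates_if_uniform_bounds)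
      have "(1 - B\<^sup>2) / (1 + B)\<^sup>2 = (1 - B) / (1 + B)"
        using 4 by (simp add: power2_eq_square divide_simps) (simp add: algebra_simps)
      then show "m * (1 + A) * (1 + B) / (4 * (A - B)) \<le> r + (1 - B\<^sup>2) / (1 + B)\<^sup>2"
        using iv 4 by linarith
    qed (use 4 AB m in auto)
  qed
qed

section \<open>The differential equation in the half-plane coordinate\<close>

lemma norm_linear_imaginary:
  "norm (of_real a + of_real b * (\<i> * of_real \<rho>)) = sqrt (a\<^sup>2 + b\<^sup>2 * \<rho>\<^sup>2)"
  by (simp add: cmod_def power_mult_distrib)

text \<open>
  Here \<open>P\<close> is the value of \<open>z\<^sup>2 * p''\<close> and \<open>\<zeta>\<close> that of \<open>c * z\<close>. Since \<open>s\<close> is real, the real part of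
  the equation involves \<open>\<kappa>\<close> through \<open>Re \<kappa>\<close>, which the hypotheses control.
\<close>

lemma ode_excludes_imaginary_value:
  fixes A B m \<rho> s :: real and \<kappa> \<zeta> P N D :: complex
  assumes B: "-1 \<le> B" "B < A" "A \<le> 1"
    and dom: "dominates A B m (Re \<kappa>) \<rho>"
    and \<zeta>: "norm \<zeta> < m"
    and s: "s \<le> - (1 + \<rho>\<^sup>2) / 2" and sP: "s + Re P \<le> 0"
    and N: "N = of_real (1 - A) + of_real (1 + A) * (\<i> * of_real \<rho>)"
    and D: "D = of_real (1 - B) + of_real (1 + B) * (\<i> * of_real \<rho>)"
  shows "P - of_real (2 * (1 + B)) * (of_real s)\<^sup>2 / D + (\<kappa> + 1) * of_real s
           + \<zeta> * N * D / of_real (8 * (A - B)) \<noteq> 0" (is "?X \<noteq> 0")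
proof -
  let ?T = "1 + \<rho>\<^sup>2"
  define E where "E = (1 - B)\<^sup>2 + (1 + B)\<^sup>2 * \<rho>\<^sup>2"
  define M where "M = coercivity B (Re \<kappa>) \<rho>"
  have T: "?T > 0" by (simp add: add_pos_nonneg)
  have s0: "s \<le> 0"
  proof -
    have "- ?T / 2 \<le> 0" using T by simp
    then show ?thesis using s by (rule order_trans[rotated])
  qed
  have M: "M > 0" and M_ge: "m * (norm N * norm D) \<le> 4 * (A - B) * ?T * M"
    using dom unfolding dominates_def M_def N D norm_linear_imaginary by auto
  have E: "E > 0" using B by (simp add: E_def add_pos_nonneg)
  have B2: "1 - B\<^sup>2 \<ge> 0" using B by (simp add: abs_square_le_1)
  have "Re (of_real (2 * (1 + B)) * (of_real s)\<^sup>2 / D) = 2 * (1 + B) * s\<^sup>2 * Re (1 / D)"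
    by (simp flip: of_real_power of_real_mult add: Re_divide)
  also have "Re (1 / D) = (1 - B) / E"
    by (simp add: D E_def Re_divide power_mult_distrib)
  also have "2 * (1 + B) * s\<^sup>2 * ((1 - B) / E) = 2 * (1 - B\<^sup>2) * s\<^sup>2 / E"
  proof -
    have "2 * (1 + B) * s\<^sup>2 * (1 - B) = 2 * (1 - B\<^sup>2) * s\<^sup>2"
      by (simp add: power2_eq_square algebra_simps)
    then show ?thesis by simp
  qed
  finally have quad: "Re (of_real (2 * (1 + B)) * (of_real s)\<^sup>2 / D) = 2 * (1 - B\<^sup>2) * s\<^sup>2 / E" .
  have "s * Re \<kappa> - 2 * (1 - B\<^sup>2) * s\<^sup>2 / E = s * (Re \<kappa> + (1 - B\<^sup>2) * (- 2 * s) / E)"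
    by (simp add: power2_eq_square diff_divide_distrib algebra_simps)
  also have "\<dots> \<le> s * M"
  proof (rule mult_left_mono_neg)
    have "(1 - B\<^sup>2) * ?T / E \<le> (1 - B\<^sup>2) * (- 2 * s) / E"
      using s E B2 by (intro divide_right_mono mult_left_mono) auto
    then show "M \<le> Re \<kappa> + (1 - B\<^sup>2) * (- 2 * s) / E" by (simp add: M_def E_def coercivity_def)
  qed (rule s0)
  also have "\<dots> \<le> - ?T / 2 * M" using s M by (intro mult_right_mono) auto
  finally have main: "s * Re \<kappa> - 2 * (1 - B\<^sup>2) * s\<^sup>2 / E \<le> - ?T / 2 * M" .
  \<comment> \<open>\<open>N\<close> vanishes for \<open>A = 1\<close>, \<open>\<rho> = 0\<close>; strictness then comes from the positive right-hand side.\<close>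
  have "norm (\<zeta> * N * D) < 4 * (A - B) * ?T * M"
  proof (cases "norm N * norm D = 0")
    case True
    then show ?thesis using B T M by (auto simp: norm_mult)
  next
    case False
    then have "norm \<zeta> * (norm N * norm D) < m * (norm N * norm D)"
      using \<zeta> by (intro mult_strict_right_mono) auto
    then show ?thesis using M_ge by (simp add: norm_mult mult.assoc)
  qed
  then have "norm (\<zeta> * N * D) / (8 * (A - B)) < 4 * (A - B) * ?T * M / (8 * (A - B))"
    using B by (intro divide_strict_right_mono) auto
  also have "4 * d * ?T * M / (8 * d) = ?T / 2 * M" if "d \<noteq> 0" for d :: real
    using that by simp
  then have "4 * (A - B) * ?T * M / (8 * (A - B)) = ?T / 2 * M"
    using B by (metis eq_iff_diff_eq_0 less_irrefl)
  finally have "norm (\<zeta> * N * D / of_real (8 * (A - B))) < ?T / 2 * M"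
    using B unfolding norm_divide norm_of_real by simp
  then have "Re (\<zeta> * N * D / of_real (8 * (A - B))) < ?T / 2 * M"
    using complex_Re_le_cmod le_less_trans by blast
  moreover have "Re ((\<kappa> + 1) * of_real s) = s * Re \<kappa> + s" by (simp add: algebra_simps)
  ultimately have "Re ?X < 0" using main quad sP
    unfolding plus_complex.sel minus_complex.sel by linarith
  then show ?thesis by (metis less_irrefl zero_complex.sel(1))
qed

text \<open>
  \<open>V = (1 + A) - (1 + B) * u\<close> is the denominator of \<open>p\<close> as a function of \<open>u\<close>, and it satisfies
  \<open>D * V = 2 * (A - B)\<close>. With \<open>p1\<close> and \<open>p2\<close> the derivatives of \<open>p\<close> from the quotient rule, the left-hand
  side is \<open>D * z / V\<close> times the difference of the two sides of the equation for \<open>u\<close>: the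
  quadratic term in \<open>z * p1\<close> cancels the part of \<open>p2\<close> that is quadratic in \<open>u1\<close>.
\<close>

lemma transformed_ode:
  fixes A B :: real and z u u1 u2 \<kappa> q V D :: complex
  assumes "B < A" "V \<noteq> 0" "D * V = of_real (2 * (A - B))"
    and ode: "z * u2 + (\<kappa> + 1) * u1 = q * u"
  defines "p1 \<equiv> of_real (2 * (A - B)) * u1 / V\<^sup>2"
    and "p2 \<equiv> of_real (2 * (A - B)) * (u2 / V\<^sup>2 + 2 * of_real (1 + B) * u1\<^sup>2 / V ^ 3)"
  shows "z\<^sup>2 * p2 - of_real (2 * (1 + B)) * (z * p1)\<^sup>2 / D + (\<kappa> + 1) * (z * p1)
           + (- 4 * q * z) * (u * D) * D / of_real (8 * (A - B)) = 0" (is "?L = 0")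
proof -
  have "D \<noteq> 0" using assms by auto
  have four: "of_real (8 * (A - B)) = 4 * (D * V)" using assms(3) by simp
  define \<beta> :: complex where "\<beta> = of_real (2 * (1 + B))"
  have p1: "p1 = D * u1 / V"
    using \<open>V \<noteq> 0\<close> unfolding p1_def assms(3)[symmetric] by (simp add: power2_eq_square)
  have p2: "p2 = D * u2 / V + \<beta> * D * u1\<^sup>2 / V\<^sup>2"
  proof -
    have "2 * of_real (1 + B) = \<beta>" by (simp add: \<beta>_def)
    then have "p2 = D * V * (u2 / V\<^sup>2 + \<beta> * u1\<^sup>2 / V ^ 3)"
      unfolding p2_def assms(3) by simp
    then show ?thesis
      using \<open>V \<noteq> 0\<close> by (simp add: distrib_left power2_eq_square power3_eq_cube)
  qed
  have "\<beta> * (z * p1)\<^sup>2 / D = z\<^sup>2 * (\<beta> * D * u1\<^sup>2 / V\<^sup>2)"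
    using \<open>D \<noteq> 0\<close> unfolding p1 by (simp add: power2_eq_square)
  moreover have "(- 4 * q * z) * (u * D) * D / (4 * (D * V)) = - (D * z / V) * (q * u)"
    using \<open>V \<noteq> 0\<close> \<open>D \<noteq> 0\<close> by (simp add: divide_simps)
  ultimately have "?L = D * z / V * (z * u2 + (\<kappa> + 1) * u1 - q * u)"
    unfolding four \<beta>_def[symmetric] p2 unfolding p1
    by (simp only:) (simp add: power2_eq_square ring_distribs add_divide_distrib diff_divide_distrib mult_ac)
  then show ?thesis using ode by simp
qed

text \<open>
  The subordinating function is the Cayley transform \<open>(p - 1) / (p + 1)\<close>, written in terms of \<open>u\<close>
  as \<open>(u - 1) / (A - B * u)\<close>.
\<close>

lemma in_janowski_class_if_Re_pos:
  fixes A B :: real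
  assumes AB: "-1 \<le> B" "B < A" "A \<le> 1"
    and hol: "u holomorphic_on ball 0 1" and u0: "u 0 = 1"
    and ne: "\<And>z. z \<in> ball 0 1 \<Longrightarrow> of_real (1 + A) - of_real (1 + B) * u z \<noteq> 0"
    and pos: "\<And>z. z \<in> ball 0 1 \<Longrightarrow>
      Re ((of_real (1 - B) * u z - of_real (1 - A)) / (of_real (1 + A) - of_real (1 + B) * u z)) > 0"
  shows "u \<in> janowski_class A B"
proof -
  define w where "w = (\<lambda>z. (u z - 1) / (of_real A - of_real B * u z))"
  have w: "of_real A - of_real B * u z \<noteq> 0" "norm (w z) < 1" if "z \<in> ball 0 1" for z
  proof -
    define V where "V = of_real (1 + A) - of_real (1 + B) * u z"
    define W where "W = of_real A - of_real B * u z"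
    let ?p = "(of_real (1 - B) * u z - of_real (1 - A)) / V"
    have V: "V \<noteq> 0" using ne[OF that] by (simp add: V_def)
    have pos': "Re ?p > 0" using pos[OF that] by (simp add: V_def)
    have plus: "?p + 1 = 2 * W / V"
      using V by (simp add: divide_simps) (simp add: V_def W_def algebra_simps)
    have minus: "?p - 1 = 2 * (u z - 1) / V"
      using V by (simp add: divide_simps) (simp add: V_def algebra_simps)
    have "Re (?p + 1) > 0" using pos' by simp
    then have W: "W \<noteq> 0" unfolding plus by auto
    then show "of_real A - of_real B * u z \<noteq> 0" by (simp add: W_def)
    have "w z = (u z - 1) / W" by (simp add: w_def W_def)
    also have "\<dots> = (?p - 1) / (?p + 1)" unfolding plus minus using V W by (simp add: divide_simps)
    finally show "norm (w z) < 1" using cayley_norm_less_1[OF pos'] by simp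
  qed
  have den: "1 + of_real B * v \<noteq> 0" if "norm v < 1" for v :: complex
  proof
    assume "1 + of_real B * v = 0"
    then have "norm (of_real B * v) = 1" by (metis add_eq_0_iff norm_minus_cancel norm_one)
    moreover have "norm (of_real B * v) \<le> 1 * norm v"
      unfolding norm_mult norm_of_real using AB by (intro mult_right_mono) auto
    ultimately show False using that by simp
  qed
  have "u z = (1 + of_real A * w z) / (1 + of_real B * w z)" if "z \<in> ball 0 1" for z
  proof -
    define W where "W = of_real A - of_real B * u z"
    have W: "W \<noteq> 0" using w(1)[OF that] by (simp add: W_def)
    have w_eq: "w z = (u z - 1) / W" by (simp add: w_def W_def)
    have "1 + of_real A * w z = of_real (A - B) * u z / W" "1 + of_real B * w z = of_real (A - B) / W"
      unfolding w_eq using W by (simp_all add: divide_simps) (simp_all add: W_def algebra_simps)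
    then show ?thesis using W AB by simp
  qed
  moreover have "w holomorphic_on ball 0 1"
    unfolding w_def using hol w(1) by (intro holomorphic_intros) auto
  moreover have "w 0 = 0" by (simp add: w_def u0)
  moreover have "(\<lambda>z. (1 + of_real A * z) / (1 + of_real B * z)) holomorphic_on ball 0 1"
    using den by (intro holomorphic_intros) auto
  ultimately have "subordinate u (\<lambda>z. (1 + of_real A * z) / (1 + of_real B * z))"
    unfolding subordinate_def using w(2) hol by (intro conjI exI[of _ w]) auto
  then show ?thesis using hol u0 by (simp add: janowski_class_def)
qed

section \<open>Solutions in the Janowski class\<close>

lemma ode_solution_in_janowski_class:
  fixes A B :: real and u u1 u2 :: "complex \<Rightarrow> complex"
  assumes AB: "-1 \<le> B" "B < A" "A \<le> 1" and "q \<noteq> 0"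
    and u1: "\<And>z. z \<in> ball 0 1 \<Longrightarrow> (u has_field_derivative u1 z) (at z)"
    and u2: "\<And>z. z \<in> ball 0 1 \<Longrightarrow> (u1 has_field_derivative u2 z) (at z)"
    and u0: "u 0 = 1"
    and ode: "\<And>z. z \<in> ball 0 1 \<Longrightarrow> z * u2 z + (\<kappa> + 1) * u1 z = q * u z"
    and dom: "\<And>\<rho>. dominates A B (4 * norm q) (Re \<kappa>) \<rho>"
    and ne: "\<And>z. z \<in> ball 0 1 \<Longrightarrow> of_real (1 + A) - of_real (1 + B) * u z \<noteq> 0"
  shows "u \<in> janowski_class A B"
proof (rule in_janowski_class_if_Re_pos[where u = u, OF AB])
  show "u 0 = 1" by (rule u0)
  show "of_real (1 + A) - of_real (1 + B) * u z \<noteq> 0" if "z \<in> ball 0 1" for z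
    using that by (rule ne)
  show "u holomorphic_on ball 0 1" unfolding holomorphic_on_open[OF open_ball] using u1 by blast
  define V where "V = (\<lambda>z. of_real (1 + A) - of_real (1 + B) * u z)"
  define p where "p = (\<lambda>z. (of_real (1 - B) * u z - of_real (1 - A)) / V z)"
  define p1 where "p1 = (\<lambda>z. of_real (2 * (A - B)) * u1 z / (V z)\<^sup>2)"
  define p2 where "p2 = (\<lambda>z. of_real (2 * (A - B)) *
    (u2 z / (V z)\<^sup>2 + 2 * of_real (1 + B) * (u1 z)\<^sup>2 / V z ^ 3))"
  have V: "V z \<noteq> 0" if "z \<in> ball 0 1" for z using ne[OF that] by (simp add: V_def)
  have dV: "(V has_field_derivative - (of_real (1 + B) * u1 z)) (at z)" if "z \<in> ball 0 1" for z
    unfolding V_def by (rule derivative_eq_intros u1 that refl)+ simp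
  have d1: "(p has_field_derivative p1 z) (at z)" if "z \<in> ball 0 1" for z
  proof -
    have "(p has_field_derivative ((of_real (1 - B) * u1 z) * V z
        - (of_real (1 - B) * u z - of_real (1 - A)) * (- (of_real (1 + B) * u1 z))) / (V z * V z)) (at z)"
      unfolding p_def
    proof (rule DERIV_divide)
      show "((\<lambda>z. of_real (1 - B) * u z - of_real (1 - A)) has_field_derivative of_real (1 - B) * u1 z) (at z)"
        by (rule derivative_eq_intros u1 that refl)+ simp
    qed (rule dV[OF that] V[OF that])+
    moreover have "(of_real (1 - B) * u1 z) * V z
        - (of_real (1 - B) * u z - of_real (1 - A)) * (- (of_real (1 + B) * u1 z))
        = of_real (2 * (A - B)) * u1 z"
      unfolding V_def by (simp add: algebra_simps)
    ultimately show ?thesis by (simp add: p1_def power2_eq_square)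
  qed
  have d2: "(p1 has_field_derivative p2 z) (at z)" if "z \<in> ball 0 1" for z
  proof -
    let ?k = "of_real (2 * (A - B)) :: complex" and ?b = "of_real (1 + B) :: complex"
    have "((\<lambda>z. (V z)\<^sup>2) has_field_derivative 2 * V z * (- (?b * u1 z))) (at z)"
      by (rule derivative_eq_intros dV that refl)+ simp
    then have "(p1 has_field_derivative
        ((?k * u2 z) * (V z)\<^sup>2 - ?k * u1 z * (2 * V z * (- (?b * u1 z)))) / ((V z)\<^sup>2 * (V z)\<^sup>2)) (at z)"
      unfolding p1_def using V[OF that] u2[OF that] by (intro DERIV_divide DERIV_cmult) auto
    moreover have "((?k * u2 z) * (V z)\<^sup>2 - ?k * u1 z * (2 * V z * (- (?b * u1 z)))) / ((V z)\<^sup>2 * (V z)\<^sup>2)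
        = p2 z"
      using V[OF that] unfolding p2_def
      by (simp add: add_divide_distrib distrib_left power2_eq_square power3_eq_cube mult_ac
          del: of_real_mult of_real_add of_real_diff)
    ultimately show ?thesis by simp
  qed
  have p0: "p 0 = 1"
  proof -
    have "V 0 = of_real (A - B)" "of_real (1 - B) * u 0 - of_real (1 - A) = of_real (A - B)"
      by (simp_all add: V_def u0)
    then show ?thesis using AB by (simp add: p_def)
  qed
  fix y :: complex assume y: "y \<in> ball 0 1"
  have "Re (p y) > 0"
  proof (rule ccontr)
    assume "\<not> ?thesis"
    then have "Re (p y) \<le> 0" by simp
    with first_exit_from_right_half_plane[OF d1 d2 p0 y]
    obtain z \<rho> s where z: "z \<in> ball 0 1" "p z = \<i> * of_real \<rho>" "z * p1 z = of_real s"
        "s \<le> - (1 + \<rho>\<^sup>2) / 2" "s + Re (z\<^sup>2 * p2 z) \<le> 0"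
      by metis
    define D where "D = of_real (1 - B) + of_real (1 + B) * p z"
    have DV: "D * V z = of_real (2 * (A - B))" and N: "u z * D = of_real (1 - A) + of_real (1 + A) * p z"
    proof -
      have pV: "p z * V z = of_real (1 - B) * u z - of_real (1 - A)"
        using V[OF z(1)] by (simp add: p_def)
      have "D * V z = of_real (1 - B) * V z + of_real (1 + B) * (p z * V z)"
        by (simp only: D_def ring_distribs mult_ac)
      also have "\<dots> = of_real (2 * (A - B))"
        unfolding pV unfolding V_def by (simp add: algebra_simps)
      finally show DV: "D * V z = of_real (2 * (A - B))" .
      have "(of_real (1 - A) + of_real (1 + A) * p z) * V z
          = of_real (1 - A) * V z + of_real (1 + A) * (p z * V z)"
        by (simp only: ring_distribs mult_ac)
      also have "\<dots> = of_real (2 * (A - B)) * u z"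
        unfolding pV unfolding V_def by (simp add: algebra_simps)
      also have "\<dots> = (u z * D) * V z" unfolding DV[symmetric] by (simp only: mult_ac)
      finally show "u z * D = of_real (1 - A) + of_real (1 + A) * p z"
        using V[OF z(1)] by simp
    qed
    have "z\<^sup>2 * p2 z - of_real (2 * (1 + B)) * (z * p1 z)\<^sup>2 / D + (\<kappa> + 1) * (z * p1 z)
           + (- 4 * q * z) * (u z * D) * D / of_real (8 * (A - B)) = 0"
      unfolding p1_def p2_def using AB(2) V[OF z(1)] DV ode[OF z(1)] by (rule transformed_ode)
    moreover have "norm (- 4 * q * z) < 4 * norm q"
      using z(1) \<open>q \<noteq> 0\<close> by (simp add: norm_mult)
    note ode_excludes_imaginary_value[OF AB dom this z(4,5) N[unfolded z(2)] D_def[unfolded z(2)]]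
    ultimately show False unfolding z(3) by simp
  qed
  then show "Re ((of_real (1 - B) * u y - of_real (1 - A)) / (of_real (1 + A) - of_real (1 + B) * u y)) > 0"
    by (simp add: p_def V_def)
qed

theorem theorem2p2:
  fixes A B :: real and b c lam \<kappa> :: complex
  assumes "-1 \<le> B" and "B < A" and "A \<le> 1"
    and "c \<noteq> 0"
    and "\<kappa> = bessel_kappa lam b"
    and "\<kappa> \<notin> \<int>\<^sub>\<le>\<^sub>0"
    and "B = -1 \<and> A \<le> 3 - 2 * sqrt 2 \<Longrightarrow>
           Re \<kappa> \<ge> cmod c / (4 * (1 + A)) * (sqrt (2 * (1 + A\<^sup>2)) + (1 - A))"
    and "B = -1 \<and> A > 3 - 2 * sqrt 2 \<Longrightarrow>
           Re \<kappa> \<ge> cmod c * (1 + A) / (8 * sqrt A) \<and>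
           (A \<noteq> 1 \<longrightarrow> Re \<kappa> \<le> cmod c * (1 + A) / (4 * (1 - A)))"
    and "-1 < B \<and> B < 0 \<Longrightarrow>
           Re \<kappa> \<ge> cmod c * (1 + A) * (1 - B)\<^sup>2 / (4 * (A - B) * (1 + B)) - (1 + B) / (1 - B)"
    and "B \<ge> 0 \<Longrightarrow>
           Re \<kappa> \<ge> cmod c * (1 + A) * (1 + B) / (4 * (A - B)) - (1 - B) / (1 + B)"
    and "\<forall>z\<in>ball 0 1. (1 + of_real B) * gen_bessel (lam + 1) b c z \<noteq> 1 + of_real A"
  shows "(\<lambda>z. - (4 * \<kappa> / c) * deriv (gen_bessel lam b c) z) \<in> janowski_class A B"
proof -
  define q where "q = - c / 4"
  define F where "F = bessel_fps (\<kappa> + 1) q"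
  have q: "q \<noteq> 0" "4 * norm q = norm c" using \<open>c \<noteq> 0\<close> by (auto simp: q_def norm_divide)
  have \<kappa>: "\<kappa> \<noteq> 0" "\<kappa> + 1 \<notin> \<int>\<^sub>\<le>\<^sub>0"
    using \<open>\<kappa> \<notin> \<int>\<^sub>\<le>\<^sub>0\<close> plus_one_in_nonpos_Ints_imp by auto
  have radius: "fps_conv_radius F = \<infinity>" "fps_conv_radius (fps_deriv F) = \<infinity>"
      "fps_conv_radius (fps_deriv (fps_deriv F)) = \<infinity>"
    using bessel_fps_conv_radius[OF \<kappa>(2) q(1)] fps_conv_radius_deriv[of F]
      fps_conv_radius_deriv[of "fps_deriv F"] by (simp_all add: F_def)
  have u: "gen_bessel (lam + 1) b c = eval_fps F"
    using assms(5) by (intro ext) (simp add: gen_bessel_eq_eval_fps F_def q_def bessel_kappa_def add_ac)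
  have "deriv (gen_bessel lam b c) z = q / \<kappa> * eval_fps F z" for z
  proof -
    have "gen_bessel lam b c = eval_fps (bessel_fps \<kappa> q)"
      using assms(5) by (intro ext) (simp add: gen_bessel_eq_eval_fps q_def)
    moreover have "(eval_fps (bessel_fps \<kappa> q) has_field_derivative
        eval_fps (fps_deriv (bessel_fps \<kappa> q)) z) (at z)"
      using bessel_fps_conv_radius[OF assms(6) q(1)] by (intro has_field_derivative_eval_fps) simp
    ultimately show ?thesis
      using radius(1) by (simp add: DERIV_imp_deriv fps_deriv_bessel_fps eval_fps_mult F_def)
  qed
  then have "(\<lambda>z. - (4 * \<kappa> / c) * deriv (gen_bessel lam b c) z) = eval_fps F"
    using \<open>c \<noteq> 0\<close> \<kappa>(1) by (intro ext) (simp add: q_def)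
  moreover have "eval_fps F \<in> janowski_class A B"
  proof (rule ode_solution_in_janowski_class[OF assms(1-3) q(1)])
    fix z :: complex
    show "(eval_fps F has_field_derivative eval_fps (fps_deriv F) z) (at z)"
      "(eval_fps (fps_deriv F) has_field_derivative eval_fps (fps_deriv (fps_deriv F)) z) (at z)"
      using radius by (auto intro!: has_field_derivative_eval_fps)
    have conv: "fps_conv_radius (fps_X * fps_deriv (fps_deriv F)) = \<infinity>"
        "fps_conv_radius (fps_const (\<kappa> + 1) * fps_deriv F) = \<infinity>"
      using fps_conv_radius_mult[of fps_X "fps_deriv (fps_deriv F)"]
        fps_conv_radius_mult[of "fps_const (\<kappa> + 1)" "fps_deriv F"] radius by simp_all
    have "eval_fps (fps_X * fps_deriv (fps_deriv F) + fps_const (\<kappa> + 1) * fps_deriv F) z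
        = eval_fps (fps_const q * F) z"
      unfolding F_def bessel_fps_ode[OF \<kappa>(2)] ..
    then show "z * eval_fps (fps_deriv (fps_deriv F)) z + (\<kappa> + 1) * eval_fps (fps_deriv F) z
        = q * eval_fps F z"
      by (subst (asm) eval_fps_add) (simp_all add: conv radius eval_fps_mult)
  next
    show "eval_fps F 0 = 1" by (simp add: eval_fps_at_0 F_def bessel_fps_def)
  next
    fix \<rho> :: real
    show "dominates A B (4 * norm q) (Re \<kappa>) \<rho>"
      unfolding q(2)
    proof (rule janowski_conditions_dominate[OF assms(1-3)])
      show "cmod c > 0" using \<open>c \<noteq> 0\<close> by simp
    qed (use assms(7-10) in blast)+
  next
    fix z :: complex assume "z \<in> ball 0 1"
    then show "of_real (1 + A) - of_real (1 + B) * eval_fps F z \<noteq> 0"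
      using assms(11) by (auto simp: u)
  qed
  ultimately show ?thesis by simp
qed

end
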